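(* Let $n\ge 3$ be an integer divisible by $3$, and let $\mathcal{O}_3(n)$ and $\mathcal{O}_6(n)$ denote the number of orbits of size $3$ and of size $6$, respectively, of the action of the dihedral group $D_6$ of order $6$ on the set $\mathcal{B}_n$ of triple points of the Böröczky configuration of size $n$. Then $$\mathcal{O}_3(n)=\left\lfloor\frac{n-1}{2}\right\rfloor-1,\qquad \mathcal{O}_6(n)=\frac{n(n-3)}{36}-\frac12\left\lfloor\frac{n-1}{2}\right\rfloor+\frac12 .$$
   Context: Böröczky configuration. For a real number $\theta$ let $P_\theta=(\cos\theta,\sin\theta)$ be the point of the unit circle in $\mathbb{R}^2$ with angle $\theta$. For $n\ge 3$ and $0\le j\le n-1$, let $L_j$ be the line through $P_{2\pi j/n}$ and $P_{\pi-4\pi j/n}$ if these points are distinct, and the tangent line to the unit circle at $P_{2\pi j/n}$ if they coincide. Let $\mathcal{L}_n=\{L_j: 0\le j\le n-1\}$. A triple point is a point of the plane where exactly three lines of $\mathcal{L}_n$ meet; $\mathcal{B}_n$ denotes the set of triple points. $D_6$, the dihedral group of order $6$, acts on the plane as the symmetry group of an equilateral triangle centered at the origin, generated by the rotation by $2\pi/3$ about the origin and the reflection $(a,b)\mapsto(a,-b)$. When $3\mid n$ this action maps $\mathcal{B}_n$ to itself. *)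

theory Defs
  imports "HOL-Analysis.Analysis" "HOL-Algebra.Group_Action" "HOL-Algebra.Generated_Groups"
begin

type_synonym plane = "real \<times> real"

definition circle_point :: "real \<Rightarrow> plane" where
  "circle_point \<theta> = (cos \<theta>, sin \<theta>)"

definition tangent_line :: "plane \<Rightarrow> plane set" where
  "tangent_line P = {X. inner (X - P) P = 0}"

definition boroczky_line :: "nat \<Rightarrow> nat \<Rightarrow> plane set" where
  "boroczky_line n j =
     (let P = circle_point (2 * pi * real j / real n);
          Q = circle_point (pi - 4 * pi * real j / real n)
      in if P \<noteq> Q then affine hull {P, Q} else tangent_line P)"

definition boroczky_lines :: "nat \<Rightarrow> plane set set" where
  "boroczky_lines n = boroczky_line n ` {0..<n}"

definition triple_points :: "nat \<Rightarrow> plane set" where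
  "triple_points n = {X. card {L \<in> boroczky_lines n. X \<in> L} = 3}"

definition rotation :: "real \<Rightarrow> plane \<Rightarrow> plane" where
  "rotation t = (\<lambda>(a, b). (cos t * a - sin t * b, sin t * a + cos t * b))"

definition x_reflection :: "plane \<Rightarrow> plane" where
  "x_reflection = (\<lambda>(a, b). (a, - b))"

definition dihedral6 :: "(plane \<Rightarrow> plane) monoid" where
  "dihedral6 = BijGroup UNIV
     \<lparr>carrier := generate (BijGroup UNIV) {rotation (2 * pi / 3), x_reflection}\<rparr>"

text \<open>The restriction is needed because the group \<open>BijGroup E\<close> of the library consists of
  functions that are undefined outside \<open>E\<close>.\<close>

definition triple_point_action :: "nat \<Rightarrow> (plane \<Rightarrow> plane) \<Rightarrow> plane \<Rightarrow> plane" where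
  "triple_point_action n g = restrict g (triple_points n)"

definition num_orbits_of_size :: "nat \<Rightarrow> nat \<Rightarrow> nat" where
  "num_orbits_of_size k n =
     card {S \<in> orbits dihedral6 (triple_points n) (triple_point_action n). card S = k}"

lemma rotation_add: "rotation s (rotation t X) = rotation (s + t) X"
  by (cases X) (simp add: rotation_def cos_add sin_add algebra_simps)

lemma rotation_0: "rotation 0 X = X"
  by (cases X) (simp add: rotation_def)

lemma dihedral6_generators:
  "{rotation (2 * pi / 3), x_reflection} \<subseteq> carrier (BijGroup UNIV)"
proof -
  have "bij (rotation t)" for t
    by (rule bij_betw_byWitness[where f' = "rotation (- t)"])
       (auto simp: rotation_add rotation_0)
  moreover have "bij x_reflection"
    by (rule bij_betw_byWitness[where f' = x_reflection]) (auto simp: x_reflection_def)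
  ultimately show ?thesis
    by (auto simp: BijGroup_def Bij_def)
qed

lemma group_dihedral6: "group dihedral6"
  unfolding dihedral6_def
  by (intro subgroup.subgroup_is_group group.generate_is_subgroup group_BijGroup
      dihedral6_generators)

end

theory Submission
  imports Defs
begin

text \<open>
  With \<open>\<beta> = \<pi>j/n\<close> the line \<open>L\<^sub>j\<close> is \<open>x sin \<beta> + y cos \<beta> = sin 3\<beta>\<close>. Writing \<open>p = x + iy\<close> and
  \<open>w = exp (2i\<beta>)\<close>, this says that \<open>w\<close> is a root of \<open>z\<^sup>3 - p z\<^sup>2 + p* z - 1\<close>, where \<open>p*\<close> is the conjugate
  of \<open>p\<close>. A triple point is therefore the same thing as a set of three distinct \<open>n\<close>-th roots of unity
  with product 1, the point being their sum; conversely such a sum always has the right cubic, because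
  the second elementary symmetric function of unit numbers with product 1 is the conjugate of the
  first. Counting ordered pairs gives \<open>(n\<^sup>2 - 3n + 6)/6\<close> triples.

  On sums, the dihedral group acts by cube roots of unity and conjugation. The origin is a fixed
  triple point, and every other orbit has size 6 unless it contains a real point, which is then
  unique and makes the size 3. For real \<open>p\<close> the cubic has the root 1, so the real triple points
  are \<open>1 + 2 cos (2\<pi>j/n)\<close> with \<open>1 \<le> j \<le> (n - 1) div 2\<close>, the value 0 being attained at \<open>j = n/3\<close>.
\<close>

section \<open>Equations of the lines\<close>

text \<open>Both end points have inner product \<open>cos d\<close> with the unit vector at angle
  \<open>m\<close>, so the right-hand side is the normal form of the chord. It stays valid when
  \<open>sin d = 0\<close>, where it describes the tangent.\<close>

lemma chord_or_tangent_eq: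
  defines "line \<equiv> (\<lambda>P Q. if P \<noteq> Q then affine hull {P, Q} else tangent_line P)"
  shows "line (circle_point (m + d)) (circle_point (m - d))
    = {(x, y). x * cos m + y * sin m = cos d}"
proof -
  let ?P = "circle_point (m + d)" and ?Q = "circle_point (m - d)"
  have m: "sin m * sin m + cos m * cos m = 1" and d: "sin d * sin d + cos d * cos d = 1"
    using sin_cos_squared_add[of m] sin_cos_squared_add[of d] by (simp_all add: power2_eq_square)
  show ?thesis
  proof (cases "sin d = 0")
    case True
    have PQ: "?P = ?Q" by (simp add: circle_point_def cos_add sin_add cos_diff sin_diff True)
    have P: "?P = (cos d * cos m, cos d * sin m)"
      by (simp add: circle_point_def cos_add sin_add True)
    have cd: "cos d * cos d = 1" using d True by simp
    \<comment> \<open>Here \<open>cos d\<close> is 1 or -1, and the tangent equation is the desired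
      one multiplied by \<open>cos d\<close>.\<close>
    have "((x - cos d * cos m) * (cos d * cos m) + (y - cos d * sin m) * (cos d * sin m) = 0)
      \<longleftrightarrow> x * cos m + y * sin m = cos d" for x y
    proof -
      have "(x - cos d * cos m) * (cos d * cos m) + (y - cos d * sin m) * (cos d * sin m)
        = cos d * (x * cos m + y * sin m) - (cos d * cos d) * (sin m * sin m + cos m * cos m)"
        by algebra
      also have "\<dots> = cos d * (x * cos m + y * sin m) - cos d * cos d"
        by (simp add: m)
      also have "\<dots> = cos d * (x * cos m + y * sin m - cos d)" by algebra
      finally show ?thesis using cd by auto
    qed
    then show ?thesis
      unfolding line_def using PQ[symmetric] by (auto simp: tangent_line_def P inner_prod_def)
  next
    case False
    have PQ: "?P \<noteq> ?Q"
    proof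
      assume "?P = ?Q"
      then have "cos m * sin d = 0" "sin m * sin d = 0"
        by (simp_all add: circle_point_def cos_add sin_add cos_diff sin_diff)
      then show False using False m by auto
    qed
    have "(x, y) \<in> affine hull {?P, ?Q}" if e: "x * cos m + y * sin m = cos d" for x y
    proof -
      \<comment> \<open>\<open>t\<close> is the position along the chord, measured from its midpoint
        in units of the signed half length \<open>sin d\<close>. The values 1 and -1 are the end
        points, hence the weights \<open>u\<close> and \<open>v\<close>.\<close>
      define t where "t = (y * cos m - x * sin m) / sin d"
      have t: "t * sin d = y * cos m - x * sin m" by (simp add: t_def False)
      define u v where "u = (1 + t) / 2" and "v = (1 - t) / 2"
      have "u * cos (m + d) + v * cos (m - d) = cos m * cos d - sin m * (t * sin d)"
        "u * sin (m + d) + v * sin (m - d) = sin m * cos d + cos m * (t * sin d)"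
        by (simp_all add: u_def v_def cos_add sin_add cos_diff sin_diff field_simps)
      moreover have "cos m * cos d - sin m * (t * sin d) = x"
      proof -
        have "cos m * cos d - sin m * (t * sin d) = x * (sin m * sin m + cos m * cos m)"
          unfolding t e[symmetric] by algebra
        then show ?thesis by (simp add: m)
      qed
      moreover have "sin m * cos d + cos m * (t * sin d) = y"
      proof -
        have "sin m * cos d + cos m * (t * sin d) = y * (sin m * sin m + cos m * cos m)"
          unfolding t e[symmetric] by algebra
        then show ?thesis by (simp add: m)
      qed
      ultimately have "(x, y) = u *\<^sub>R ?P + v *\<^sub>R ?Q" "u + v = 1"
        by (simp_all add: circle_point_def) (simp add: u_def v_def field_simps)
      then show ?thesis unfolding affine_hull_2 by blast
    qed
    moreover have "x * cos m + y * sin m = cos d" if hull: "(x, y) \<in> affine hull {?P, ?Q}" for x y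
    proof -
      obtain u v where uv: "u + v = 1" "(x, y) = u *\<^sub>R ?P + v *\<^sub>R ?Q"
        using hull unfolding affine_hull_2 by blast
      have v: "v = 1 - u" using uv(1) by simp
      have xy: "x = u * cos (m + d) + v * cos (m - d)" "y = u * sin (m + d) + v * sin (m - d)"
        using uv(2) by (simp_all add: circle_point_def)
      have "x * cos m + y * sin m = cos d * (sin m * sin m + cos m * cos m)"
        unfolding xy v cos_add sin_add cos_diff sin_diff by algebra
      then show ?thesis by (simp add: m)
    qed
    ultimately show ?thesis unfolding line_def using PQ by auto
  qed
qed

lemma boroczky_line_eq:
  fixes n j :: nat
  defines "\<beta> \<equiv> pi * real j / real n"
  shows "boroczky_line n j = {(x, y). x * sin \<beta> + y * cos \<beta> = sin (3 * \<beta>)}"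
proof -
  \<comment> \<open>The half sum \<open>pi / 2 - \<beta>\<close> and the half difference
    \<open>3 * \<beta> - pi / 2\<close> of the two defining angles.\<close>
  have "2 * pi * real j / real n = (pi / 2 - \<beta>) + (3 * \<beta> - pi / 2)"
    "pi - 4 * pi * real j / real n = (pi / 2 - \<beta>) - (3 * \<beta> - pi / 2)"
    by (simp_all add: \<beta>_def)
  then have "boroczky_line n j =
      {(x, y). x * cos (pi / 2 - \<beta>) + y * sin (pi / 2 - \<beta>) = cos (3 * \<beta> - pi / 2)}"
    unfolding boroczky_line_def Let_def by (simp only: chord_or_tangent_eq)
  then show ?thesis by (simp add: cos_diff sin_diff)
qed

section \<open>The lines in complex coordinates\<close>

definition plane_complex :: "plane \<Rightarrow> complex" where
  "plane_complex X = Complex (fst X) (snd X)"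

lemma bij_plane_complex: "bij plane_complex"
  by (rule bij_betw_byWitness[where f' = "\<lambda>z. (Re z, Im z)"])
     (auto simp: plane_complex_def complex_eq_iff)

text \<open>Reversing the coefficients and conjugating them only changes the sign of the polynomial.
  Hence for \<open>w\<close> on the unit circle its vanishing is a single real equation in
  \<open>p\<close>, that of a line.\<close>

definition line_cubic :: "complex \<Rightarrow> complex \<Rightarrow> complex" where
  "line_cubic p w = w ^ 3 - p * w\<^sup>2 + cnj p * w - 1"

text \<open>Dividing the cubic at the square of \<open>z = cis \<beta>\<close> by
  \<open>z ^ 3\<close> leaves \<open>z ^ 3 - p * z\<close> minus its conjugate. This is purely
  imaginary, and its vanishing is the real equation of the line.\<close>

lemma mem_boroczky_line_iff:
  "X \<in> boroczky_line n j \<longleftrightarrow> line_cubic (plane_complex X) (cis (2 * pi * real j / real n)) = 0"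
proof -
  obtain x y where X: "X = (x, y)" by (cases X)
  define \<beta> where "\<beta> = pi * real j / real n"
  define z where "z = cis \<beta>"
  define p where "p = Complex x y"
  have zz: "z * cnj z = 1" by (simp add: z_def cis_cnj cis_mult)
  have w: "cis (2 * pi * real j / real n) = z\<^sup>2"
    by (simp add: z_def \<beta>_def power2_eq_square cis_mult mult.assoc)
  have "line_cubic p (z\<^sup>2) = z ^ 3 * ((z ^ 3 - cnj (z ^ 3)) - (p * z - cnj (p * z)))"
  proof -
    have "z ^ 3 * cnj z ^ 3 = 1" "z ^ 3 * cnj z = z\<^sup>2"
      using zz by (simp_all flip: power_mult_distrib) (simp add: power2_eq_square power3_eq_cube)
    then show ?thesis
      unfolding line_cubic_def complex_cnj_power complex_cnj_mult by algebra
  qed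
  also have "z ^ 3 - cnj (z ^ 3) = complex_of_real (2 * sin (3 * \<beta>)) * \<i>"
    unfolding complex_diff_cnj z_def by (simp only: Complex.DeMoivre cis.sel) simp
  also have "p * z - cnj (p * z) = complex_of_real (2 * (x * sin \<beta> + y * cos \<beta>)) * \<i>"
    unfolding complex_diff_cnj p_def z_def by simp
  finally have eq: "line_cubic p (z\<^sup>2)
    = z ^ 3 * \<i> * complex_of_real (2 * (sin (3 * \<beta>) - (x * sin \<beta> + y * cos \<beta>)))"
    by (simp add: algebra_simps)
  have "line_cubic p (z\<^sup>2) = 0 \<longleftrightarrow> x * sin \<beta> + y * cos \<beta> = sin (3 * \<beta>)"
    unfolding eq by (auto simp: z_def simp flip: of_real_mult of_real_add of_real_diff)
  then show ?thesis
    unfolding w boroczky_line_eq X p_def plane_complex_def by (simp add: \<beta>_def)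
qed

text \<open>Triple points count lines as sets; injectivity allows indices to be counted
  instead.\<close>

lemma inj_on_boroczky_line: "inj_on (boroczky_line n) {0..<n}"
proof (rule inj_onI)
  fix j k assume jk: "j \<in> {0..<n}" "k \<in> {0..<n}" and eq: "boroczky_line n j = boroczky_line n k"
  define b c where "b = pi * real j / real n" and "c = pi * real k / real n"
  have b1: "sin b * sin b + cos b * cos b = 1"
    using sin_cos_squared_add[of b] by (simp add: power2_eq_square)
  have mem: "(x, y) \<in> boroczky_line n j \<longleftrightarrow> x * sin b + y * cos b = sin (3 * b)"
    "(x, y) \<in> boroczky_line n k \<longleftrightarrow> x * sin c + y * cos c = sin (3 * c)" for x y
    by (simp_all add: boroczky_line_eq b_def c_def)
  \<comment> \<open>The foot of the perpendicular from the origin. The second point is reached from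
    it along \<open>(cos b, - sin b)\<close>; subtracting the two equations of line \<open>k\<close>
    shows that both lines have the same direction.\<close>
  let ?x = "sin (3 * b) * sin b" and ?y = "sin (3 * b) * cos b"
  have "(?x, ?y) \<in> boroczky_line n j" "(?x + cos b, ?y - sin b) \<in> boroczky_line n j"
    unfolding mem using b1 by algebra+
  then have "?x * sin c + ?y * cos c = sin (3 * c)"
    "(?x + cos b) * sin c + (?y - sin b) * cos c = sin (3 * c)"
    unfolding eq mem by simp_all
  then have "sin (c - b) = 0" by (simp add: sin_diff algebra_simps)
  then obtain i :: int where i: "c - b = of_int i * pi" by (auto simp: sin_zero_iff_int2)
  have n: "real n > 0" using jk by simp
  have "(real k - real j) * pi = (of_int i * real n) * pi"
    using i n by (simp add: b_def c_def field_simps)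
  then have "real k - real j = of_int i * real n" by simp
  then have e: "int k - int j = i * int n"
    by (metis of_int_diff of_int_eq_iff of_int_mult of_int_of_nat_eq)
  \<comment> \<open>The indices differ by a multiple of \<open>n\<close> but lie in a range of
    length \<open>n\<close>.\<close>
  have "\<bar>int k - int j\<bar> < int n" using jk by auto
  then have "\<bar>i\<bar> * int n < 1 * int n" unfolding e by (simp add: abs_mult)
  then have "i = 0" by (simp only: mult_less_cancel_right) auto
  then show "j = k" using e by simp
qed

section \<open>Triple points and triples of roots of unity\<close>

text \<open>Unordered triples, so that a triple point determines exactly one of them.\<close>

definition unit_root_triples :: "nat \<Rightarrow> complex set set" where
  "unit_root_triples n = {A. A \<subseteq> {w. w ^ n = 1} \<and> card A = 3 \<and> \<Prod>A = 1}"

lemma finite_unit_root_triples: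
  assumes "n > 0"
  shows "finite (unit_root_triples n)"
proof -
  have "finite {w :: complex. w ^ n = 1}"
    using assms by (intro card_ge_0_finite) (simp add: Complex.card_roots_unity_eq)
  then show ?thesis
    by (rule finite_subset[rotated, OF finite_Pow_iff[THEN iffD2]]) (auto simp: unit_root_triples_def)
qed

text \<open>Its elements label the lines through \<open>p\<close>.\<close>

definition cubic_unit_roots :: "nat \<Rightarrow> complex \<Rightarrow> complex set" where
  "cubic_unit_roots n p = {w. w ^ n = 1 \<and> line_cubic p w = 0}"

lemma triple_points_eq:
  assumes "n > 0"
  shows "triple_points n = {X. card (cubic_unit_roots n (plane_complex X)) = 3}"
proof -
  have "card {L \<in> boroczky_lines n. X \<in> L} = card (cubic_unit_roots n (plane_complex X))" for X
  proof -
    let ?J = "{j \<in> {0..<n}. X \<in> boroczky_line n j}"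
    have "{L \<in> boroczky_lines n. X \<in> L} = boroczky_line n ` ?J"
      by (auto simp: boroczky_lines_def)
    moreover have "inj_on (boroczky_line n) ?J"
      using inj_on_boroczky_line by (rule inj_on_subset) auto
    ultimately have 1: "card {L \<in> boroczky_lines n. X \<in> L} = card ?J"
      by (simp only: card_image)
    let ?r = "\<lambda>k. cis (2 * pi * real k / real n)"
    have bij: "bij_betw ?r {..<n} {z. z ^ n = 1}" by (rule Complex.bij_betw_roots_unity[OF assms])
    have "cubic_unit_roots n (plane_complex X) = ?r ` ?J"
      using bij_betw_imp_surj_on[OF bij]
      by (auto simp: cubic_unit_roots_def mem_boroczky_line_iff)
    moreover have "inj_on ?r ?J"
      using bij_betw_imp_inj_on[OF bij] by (rule inj_on_subset) auto
    ultimately show ?thesis using 1 by (simp only: card_image)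
  qed
  then show ?thesis by (simp add: triple_points_def)
qed

lemma norm_unit_root: "norm w = 1" if "w ^ n = 1" "n > 0" for w :: complex
  using power_eq_1_iff[OF that(1)] that(2) by (metis less_irrefl)

lemma cnj_unit_root: "w * cnj w = 1" if "w ^ n = 1" "n > 0" for w :: complex
  unfolding complex_norm_square[symmetric] norm_unit_root[OF that] by simp

text \<open>Each conjugate is an inverse, hence the product of the other two numbers; the conjugate
  of the sum is then the second elementary symmetric function.\<close>

lemma line_cubic_factor:
  assumes "a * cnj a = 1" "b * cnj b = 1" "c * cnj c = 1" "a * b * c = 1"
  shows "line_cubic (a + b + c) w = (w - a) * (w - b) * (w - c)"
proof -
  have "cnj a = (a * cnj a) * (b * c)" "cnj b = (b * cnj b) * (a * c)" "cnj c = (c * cnj c) * (a * b)"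
    using assms(4) by (simp_all add: mult_ac)
  then have cnj: "cnj a = b * c" "cnj b = a * c" "cnj c = a * b" using assms by simp_all
  have "line_cubic (a + b + c) w = (w - a) * (w - b) * (w - c) + (a * b * c - 1)"
    unfolding line_cubic_def complex_cnj_add cnj by algebra
  then show ?thesis using assms(4) by simp
qed

lemma cubic_unit_roots_sum:
  assumes "n > 0" "A \<in> unit_root_triples n"
  shows "cubic_unit_roots n (\<Sum>A) = A"
proof -
  from assms(2) obtain a b c where A: "A = {a, b, c}" and dist: "a \<noteq> b" "a \<noteq> c" "b \<noteq> c"
    unfolding unit_root_triples_def by (auto simp: card_3_iff)
  have r: "a ^ n = 1" "b ^ n = 1" "c ^ n = 1" and abc: "a * b * c = 1"
    using assms(2) dist unfolding A unit_root_triples_def by (auto simp: mult.assoc)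
  have s: "\<Sum>A = a + b + c" unfolding A using dist by (simp add: add.assoc)
  have f: "line_cubic (a + b + c) w = (w - a) * (w - b) * (w - c)" for w
    by (intro line_cubic_factor abc cnj_unit_root[OF _ assms(1)] r)
  show ?thesis unfolding cubic_unit_roots_def s f using r by (auto simp: A)
qed

lemma cubic_unit_roots_triple:
  assumes "card (cubic_unit_roots n p) = 3"
  shows "cubic_unit_roots n p \<in> unit_root_triples n" "\<Sum>(cubic_unit_roots n p) = p"
proof -
  from assms obtain a b c where A: "cubic_unit_roots n p = {a, b, c}"
    and dist: "a \<noteq> b" "a \<noteq> c" "b \<noteq> c" by (auto simp: card_3_iff)
  have "a \<in> cubic_unit_roots n p" "b \<in> cubic_unit_roots n p" "c \<in> cubic_unit_roots n p"
    by (simp_all add: A)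
  then have r: "a ^ n = 1" "b ^ n = 1" "c ^ n = 1"
    and z: "a ^ 3 - p * a\<^sup>2 + cnj p * a - 1 = 0" "b ^ 3 - p * b\<^sup>2 + cnj p * b - 1 = 0"
      "c ^ 3 - p * c\<^sup>2 + cnj p * c - 1 = 0"
    by (simp_all add: cubic_unit_roots_def line_cubic_def)
  \<comment> \<open>Vieta's formulas by divided differences: subtract the equations of two roots and
    cancel the difference of the roots, then repeat once more.\<close>
  have "(a - b) * (a\<^sup>2 + a * b + b\<^sup>2 - p * (a + b) + cnj p) = 0"
    "(a - c) * (a\<^sup>2 + a * c + c\<^sup>2 - p * (a + c) + cnj p) = 0"
    using z by algebra+
  then have q: "a\<^sup>2 + a * b + b\<^sup>2 - p * (a + b) + cnj p = 0"
    "a\<^sup>2 + a * c + c\<^sup>2 - p * (a + c) + cnj p = 0"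
    using dist by simp_all
  have "(b - c) * (a + b + c - p) = (a\<^sup>2 + a * b + b\<^sup>2 - p * (a + b) + cnj p)
      - (a\<^sup>2 + a * c + c\<^sup>2 - p * (a + c) + cnj p)" by algebra
  then have "(b - c) * (a + b + c - p) = 0" unfolding q by simp
  then have p: "p = a + b + c" using dist by simp
  have cnj: "cnj p = a * b + a * c + b * c" using q(1) unfolding p by algebra
  have abc: "a * b * c = 1" using z(1) unfolding cnj unfolding p by algebra
  show "\<Sum>(cubic_unit_roots n p) = p" unfolding A unfolding p using dist by (simp add: add.assoc)
  show "cubic_unit_roots n p \<in> unit_root_triples n"
    unfolding A unit_root_triples_def using dist r abc by (auto simp: mult.assoc)
qed

lemma triple_points_complex:
  assumes "n > 0"
  shows "plane_complex ` triple_points n = Sum ` unit_root_triples n"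
proof -
  have "plane_complex ` triple_points n = {p. card (cubic_unit_roots n p) = 3}"
    unfolding triple_points_eq[OF assms]
    using surj_image_vimage_eq[OF bij_is_surj[OF bij_plane_complex],
        of "{p. card (cubic_unit_roots n p) = 3}"] by (simp add: vimage_def)
  also have "\<dots> = Sum ` unit_root_triples n"
  proof (intro equalityI subsetI)
    fix p assume "p \<in> {p. card (cubic_unit_roots n p) = 3}"
    then show "p \<in> Sum ` unit_root_triples n"
      using cubic_unit_roots_triple[of n p] by (auto intro!: rev_image_eqI)
  next
    fix p assume "p \<in> Sum ` unit_root_triples n"
    then show "p \<in> {p. card (cubic_unit_roots n p) = 3}"
      using cubic_unit_roots_sum[OF assms] by (auto simp: unit_root_triples_def)
  qed
  finally show ?thesis .
qed

lemma inj_on_Sum_unit_root_triples: "n > 0 \<Longrightarrow> inj_on Sum (unit_root_triples n)"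
  by (rule inj_on_inverseI[where g = "cubic_unit_roots n"]) (rule cubic_unit_roots_sum)

section \<open>Counting the triples\<close>

lemma card_distinct_pairs:
  assumes "card A = 3"
  shows "card {(a, b) \<in> A \<times> A. a \<noteq> b} = 6"
proof -
  obtain a b c where A: "A = {a, b, c}" "a \<noteq> b" "a \<noteq> c" "b \<noteq> c"
    using assms by (auto simp: card_3_iff)
  then have "{(a, b) \<in> A \<times> A. a \<noteq> b} = {(a, b), (a, c), (b, a), (b, c), (c, a), (c, b)}"
    by auto
  also have "card \<dots> = 6" using A by simp
  finally show ?thesis .
qed

lemma unit_root_triple_third:
  assumes "A \<in> unit_root_triples n" "a \<in> A" "b \<in> A" "a \<noteq> b"
  obtains c where "A = {a, b, c}" "a \<noteq> c" "b \<noteq> c" "a * b * c = 1"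
proof -
  have c3: "card A = 3" and p: "\<Prod>A = 1" using assms(1) by (simp_all add: unit_root_triples_def)
  have "card (A - {a, b}) = 1" using c3 assms by (simp add: card_Diff_subset)
  then obtain c where "A - {a, b} = {c}" by (auto simp: card_1_singleton_iff)
  then have c: "A = {a, b, c}" "a \<noteq> c" "b \<noteq> c" using assms by auto
  then have "a * b * c = 1" using p assms(4) by (simp add: mult.assoc)
  with c show thesis by (rule that)
qed

text \<open>A pair \<open>(a, b)\<close> of roots of unity extends to a triple by
  \<open>c = inverse (a * b)\<close> unless \<open>a = b\<close> (\<open>D1\<close>),
  \<open>c = a\<close> (\<open>D2\<close>) or \<open>c = b\<close> (\<open>D3\<close>). Each
  exception has \<open>n\<close> pairs, and the overlaps consist of the three diagonal pairs of cube
  roots of unity, so \<open>3 * n - 6\<close> pairs are lost. Each triple arises from six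
  pairs.\<close>

lemma card_unit_root_triples:
  assumes n: "n > 0" "3 dvd n"
  shows "6 * card (unit_root_triples n) + 3 * n = n\<^sup>2 + 6"
proof -
  let ?U = "{w :: complex. w ^ n = 1}" and ?T = "unit_root_triples n"
  define D1 where "D1 = {(a, b) \<in> ?U \<times> ?U. a = b}"
  define D2 where "D2 = {(a, b) \<in> ?U \<times> ?U. a\<^sup>2 * b = 1}"
  define D3 where "D3 = {(a, b) \<in> ?U \<times> ?U. a * b\<^sup>2 = 1}"
  define E where "E = (\<lambda>w. (w, w)) ` {w :: complex. w ^ 3 = 1}"
  have cU: "card ?U = n" by (rule Complex.card_roots_unity_eq) (rule n)
  then have fU: "finite ?U" using n by (intro card_ge_0_finite) simp
  \<comment> \<open>Divisibility by 3 enters here: all three cube roots of unity are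
    available.\<close>
  have U3: "w ^ n = 1" if "w ^ 3 = 1" for w :: complex
    using n(2) that by (auto elim!: dvdE simp: power_mult)
  have nz: "w \<noteq> 0" if "w \<in> ?U" for w using that n by (auto simp: power_0_left)
  have cE: "card E = 3"
    unfolding E_def by (subst card_image) (auto simp: inj_on_def Complex.card_roots_unity_eq)
  have "D1 = (\<lambda>w. (w, w)) ` ?U" by (auto simp: D1_def)
  then have c1: "card D1 = n" by (simp add: card_image inj_on_def cU)
  have D2: "D2 = (\<lambda>w. (w, inverse (w\<^sup>2))) ` ?U"
  proof (intro equalityI subsetI)
    fix x assume "x \<in> D2"
    then obtain a b where x: "x = (a, b)" "a \<in> ?U" "a\<^sup>2 * b = 1" by (auto simp: D2_def)
    then have "b = inverse (a\<^sup>2)" using inverse_unique by metis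
    then show "x \<in> (\<lambda>w. (w, inverse (w\<^sup>2))) ` ?U" using x by blast
  next
    fix x assume "x \<in> (\<lambda>w. (w, inverse (w\<^sup>2))) ` ?U"
    then obtain w where w: "x = (w, inverse (w\<^sup>2))" "w ^ n = 1" by auto
    moreover have "w\<^sup>2 * inverse (w\<^sup>2) = 1" using nz[of w] w by simp
    moreover have "inverse (w\<^sup>2) ^ n = 1"
      by (metis w(2) inverse_1 power_inverse power_mult mult.commute power_one)
    ultimately show "x \<in> D2" by (simp add: D2_def)
  qed
  then have c2: "card D2 = n" by (simp add: card_image inj_on_def cU)
  have "D3 = prod.swap ` D2" by (auto simp: D2_def D3_def image_iff mult.commute)
  then have c3: "card D3 = n" using c2 by (simp add: card_image)
  have sub: "D1 \<union> D2 \<union> D3 \<subseteq> ?U \<times> ?U" by (auto simp: D1_def D2_def D3_def)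
  then have fin: "finite D1" "finite D2" "finite D3"
    using finite_subset[OF _ finite_cartesian_product[OF fU fU]] by blast+
  have eq: "a = b" if "a\<^sup>2 * b = 1" "a * b\<^sup>2 = 1" "a \<in> ?U" "b \<in> ?U" for a b
  proof -
    have "(a * b) * a = (a * b) * b" using that(1,2) by (simp add: power2_eq_square mult_ac)
    then show ?thesis using nz that(3,4) by auto
  qed
  have cube: "w\<^sup>2 * w = w ^ 3" "w * w\<^sup>2 = w ^ 3" for w :: complex
    by (simp_all add: power2_eq_square power3_eq_cube)
  have i12: "D1 \<inter> D2 = E" by (auto simp: D1_def D2_def E_def cube U3)
  have i3: "(D1 \<union> D2) \<inter> D3 = E"
  proof (intro equalityI subsetI)
    fix x assume x: "x \<in> (D1 \<union> D2) \<inter> D3"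
    then obtain a b where ab: "x = (a, b)" by (cases x)
    then have "a = b" "a * b\<^sup>2 = 1" using x eq by (auto simp: D1_def D2_def D3_def)
    then show "x \<in> E" by (simp add: ab E_def cube)
  qed (auto simp: D1_def D3_def E_def cube U3)
  have c12: "card (D1 \<union> D2) + 3 = 2 * n"
    using card_Un_Int[of D1 D2] fin c1 c2 i12 cE by simp
  have cD: "card (D1 \<union> D2 \<union> D3) + 6 = 3 * n"
    using card_Un_Int[of "D1 \<union> D2" D3] fin c12 c3 i3 cE by simp
  have "?U \<times> ?U - (D1 \<union> D2 \<union> D3) = (\<Union>A\<in>?T. {(a, b) \<in> A \<times> A. a \<noteq> b})"
  proof (intro equalityI subsetI)
    fix x assume x: "x \<in> ?U \<times> ?U - (D1 \<union> D2 \<union> D3)"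
    then obtain a b where ab: "x = (a, b)" "a ^ n = 1" "b ^ n = 1" "a \<noteq> b"
      "a\<^sup>2 * b \<noteq> 1" "a * b\<^sup>2 \<noteq> 1"
      by (cases x) (auto simp: D1_def D2_def D3_def)
    have nzab: "a \<noteq> 0" "b \<noteq> 0" using nz ab by auto
    define c where "c = inverse (a * b)"
    have abc: "a * b * c = 1" using nzab unfolding c_def by (intro right_inverse) simp
    have cn: "c ^ n = 1" by (simp add: c_def power_inverse power_mult_distrib ab)
    have "a \<noteq> c" "b \<noteq> c"
      using abc ab(5,6) by (auto simp: power2_eq_square mult_ac)
    then have "{a, b, c} \<in> ?T"
      using ab cn abc by (simp add: unit_root_triples_def mult.assoc)
    then show "x \<in> (\<Union>A\<in>?T. {(a, b) \<in> A \<times> A. a \<noteq> b})" using ab by blast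
  next
    fix x assume "x \<in> (\<Union>A\<in>?T. {(a, b) \<in> A \<times> A. a \<noteq> b})"
    then obtain A a b where A: "A \<in> ?T" and ab: "x = (a, b)" "a \<in> A" "b \<in> A" "a \<noteq> b" by auto
    obtain c where Ae: "A = {a, b, c}" "a \<noteq> c" "b \<noteq> c" and abc: "a * b * c = 1"
      using unit_root_triple_third[OF A ab(2-4)] by blast
    have r: "a ^ n = 1" "b ^ n = 1" using A unfolding Ae(1) unit_root_triples_def by auto
    have nzab: "a \<noteq> 0" "b \<noteq> 0" using nz r by auto
    have "a\<^sup>2 * b \<noteq> 1"
    proof
      assume "a\<^sup>2 * b = 1"
      then have "a * b * a = a * b * c" using abc by (simp add: power2_eq_square mult_ac)
      then show False using nzab Ae by simp
    qed
    moreover have "a * b\<^sup>2 \<noteq> 1"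
    proof
      assume "a * b\<^sup>2 = 1"
      then have "a * b * b = a * b * c" using abc by (simp add: power2_eq_square mult_ac)
      then show False using nzab Ae by simp
    qed
    ultimately show "x \<in> ?U \<times> ?U - (D1 \<union> D2 \<union> D3)"
      using r ab by (auto simp: D1_def D2_def D3_def)
  qed
  moreover have "card (\<Union>A\<in>?T. {(a, b) \<in> A \<times> A. a \<noteq> b}) = 6 * card ?T"
  proof (subst card_UN_disjoint)
    show "finite ?T"
      by (rule finite_unit_root_triples) (rule n)
    show "\<forall>A\<in>?T. finite {(a, b) \<in> A \<times> A. a \<noteq> b}"
    proof
      fix A assume "A \<in> ?T"
      then have "finite (A \<times> A)"
        using fU by (auto simp: unit_root_triples_def intro: finite_subset)
      then show "finite {(a, b) \<in> A \<times> A. a \<noteq> b}" by (rule finite_subset[rotated]) auto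
    qed
    \<comment> \<open>Two elements determine the third through the product, so different triples
      share no pair.\<close>
    have "A = B" if T: "A \<in> ?T" "B \<in> ?T" and x: "a \<in> A" "b \<in> A" "a \<in> B" "b \<in> B" "a \<noteq> b" for A B a b
    proof -
      obtain c where c: "A = {a, b, c}" "a * b * c = 1"
        using unit_root_triple_third[OF T(1) x(1,2,5)] by blast
      obtain d where d: "B = {a, b, d}" "a * b * d = 1"
        using unit_root_triple_third[OF T(2) x(3,4,5)] by blast
      show ?thesis
        unfolding c(1) d(1) inverse_unique[OF c(2), symmetric] inverse_unique[OF d(2), symmetric] ..
    qed
    then show "\<forall>A\<in>?T. \<forall>B\<in>?T. A \<noteq> B \<longrightarrow>
        {(a, b) \<in> A \<times> A. a \<noteq> b} \<inter> {(a, b) \<in> B \<times> B. a \<noteq> b} = {}"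
      by blast
    show "(\<Sum>A\<in>?T. card {(a, b) \<in> A \<times> A. a \<noteq> b}) = 6 * card ?T"
      by (subst sum.cong[OF refl card_distinct_pairs]) (auto simp: unit_root_triples_def)
  qed
  moreover have "card (?U \<times> ?U - (D1 \<union> D2 \<union> D3)) + card (D1 \<union> D2 \<union> D3) = n\<^sup>2"
    using card_Diff_subset[OF _ sub] card_mono[OF _ sub] fin fU
    by (simp add: card_cartesian_product cU power2_eq_square)
  ultimately show ?thesis using cD by simp
qed

section \<open>Real triple points\<close>

lemma real_triple_sums:
  assumes n: "n > 0"
  shows "{p \<in> Sum ` unit_root_triples n. p \<in> \<real>}
    = (\<lambda>j. complex_of_real (1 + 2 * cos (2 * pi * real j / real n))) ` {1..(n - 1) div 2}"
    (is "?L = ?f ` ?J")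
proof (intro equalityI subsetI)
  fix p assume "p \<in> ?L"
  then obtain A where A: "A \<in> unit_root_triples n" "\<Sum>A = p" and p: "p \<in> \<real>" by blast
  \<comment> \<open>For real \<open>p\<close> the cubic at 1 is \<open>1 - p + p - 1\<close>, so the
    triple is 1 together with a conjugate pair.\<close>
  have "line_cubic p 1 = 0" using p by (simp add: line_cubic_def Reals_cnj_iff)
  then have 1: "1 \<in> A"
    using cubic_unit_roots_sum[OF n A(1)] A(2) by (auto simp: cubic_unit_roots_def)
  have "card A = 3" using A by (simp add: unit_root_triples_def)
  then obtain b where b: "b \<in> A" "1 \<noteq> b"
    using 1 by (auto simp: card_3_iff)
  then obtain c where c: "A = {1, b, c}" "1 \<noteq> c" "b \<noteq> c" "1 * b * c = 1"
    using unit_root_triple_third[OF A(1) 1 b] by blast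
  have bn: "b ^ n = 1" using A(1) b by (auto simp: unit_root_triples_def)
  have cb: "c = cnj b" using cnj_unit_root[OF bn n] c(4) inverse_unique by (metis mult_1)
  have p_eq: "p = complex_of_real (1 + 2 * Re b)"
    using A(2) c b(2) by (simp add: cb complex_eq_iff)
  obtain j where j: "j < n" "b = cis (2 * pi * real j / real n)"
    using bij_betw_imp_surj_on[OF Complex.bij_betw_roots_unity[OF n]] bn by auto
  have j0: "j \<noteq> 0" using j(2) b(2) by (intro notI) simp
  \<comment> \<open>Otherwise \<open>b\<close> would be -1, which equals its own conjugate
    \<open>c\<close>. This is why the range stops at \<open>(n - 1) div 2\<close>, the largest
    \<open>j\<close> with \<open>2 * j < n\<close>.\<close>
  have jh: "2 * j \<noteq> n"
  proof
    assume "2 * j = n"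
    then have "2 * pi * real j / real n = pi" using n by (auto simp: field_simps)
    then show False using j c(3) cb by simp
  qed
  show "p \<in> ?f ` ?J"
  proof (cases "2 * j < n")
    case True
    then show ?thesis using j0 j by (intro image_eqI[of _ _ j]) (auto simp: p_eq)
  next
    case False
    \<comment> \<open>Indices \<open>j\<close> and \<open>n - j\<close> give conjugate roots, so the
      upper half of the range folds onto the lower half.\<close>
    have "2 * pi * real (n - j) / real n = 2 * pi - 2 * pi * real j / real n"
      using n j by (simp add: field_simps of_nat_diff)
    then have "cos (2 * pi * real (n - j) / real n) = cos (2 * pi * real j / real n)"
      by (simp add: cos_diff)
    then show ?thesis
      using False jh j by (intro image_eqI[of _ _ "n - j"]) (auto simp: p_eq)
  qed
next
  fix p assume "p \<in> ?f ` ?J"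
  then obtain j where j: "1 \<le> j" "j \<le> (n - 1) div 2" and p: "p = ?f j" by auto
  define \<theta> where "\<theta> = 2 * pi * real j / real n"
  \<comment> \<open>Strictness puts the angle inside the open half turn; the positive sine then
    keeps the three roots distinct.\<close>
  have "2 * real j < real n" using j n by linarith
  then have \<theta>: "0 < \<theta>" "\<theta> < pi" using j n by (auto simp: \<theta>_def field_simps)
  then have s: "sin \<theta> > 0" by (rule sin_gt_zero)
  have "cis \<theta> ^ n = 1"
    using n by (auto simp: Complex.DeMoivre \<theta>_def complex_eq_iff cos_int_2pin sin_int_2pin)
  moreover have "cis (- \<theta>) ^ n = 1"
    by (metis calculation cis_cnj complex_cnj_one complex_cnj_power)
  moreover have "cis \<theta> \<noteq> cis (- \<theta>)" "cis \<theta> \<noteq> 1" "cis (- \<theta>) \<noteq> 1"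
    using s by (auto simp: complex_eq_iff)
  ultimately have "{1, cis \<theta>, cis (- \<theta>)} \<in> unit_root_triples n"
    "\<Sum>{1, cis \<theta>, cis (- \<theta>)} = ?f j"
    by (auto simp: unit_root_triples_def cis_mult \<theta>_def[symmetric] complex_eq_iff)
  then show "p \<in> ?L" unfolding p by (auto intro!: image_eqI simp del: of_real_add)
qed

text \<open>Cosine is injective on the half turn, so the real sums are counted by their indices. The
  index \<open>n div 3\<close> gives 0, which accounts for the \<open>+ 1\<close>.\<close>

lemma card_real_triple_sums:
  assumes n: "n > 0" "3 dvd n"
  shows "card {p \<in> Sum ` unit_root_triples n. p \<in> \<real> \<and> p \<noteq> 0} + 1 = (n - 1) div 2"
    and "0 \<in> Sum ` unit_root_triples n"
proof -
  let ?f = "\<lambda>j. complex_of_real (1 + 2 * cos (2 * pi * real j / real n))"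
  let ?J = "{1..(n - 1) div 2}"
  let ?R = "{p \<in> Sum ` unit_root_triples n. p \<in> \<real>}"
  have R: "?R = ?f ` ?J" by (rule real_triple_sums) (rule n)
  have "inj_on ?f ?J"
  proof (rule inj_onI)
    fix j k assume jk: "j \<in> ?J" "k \<in> ?J" and eq: "?f j = ?f k"
    have "2 * real j \<le> real n" "2 * real k \<le> real n" using jk by auto
    then have "2 * pi * real j / real n \<le> pi" "2 * pi * real k / real n \<le> pi"
      using n by (simp_all add: field_simps)
    moreover have "cos (2 * pi * real j / real n) = cos (2 * pi * real k / real n)"
      using eq by (simp only: of_real_eq_iff)
    moreover have "0 \<le> 2 * pi * real i / real n" for i by simp
    ultimately have "2 * pi * real j / real n = 2 * pi * real k / real n"
      by (metis cos_inj_pi)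
    then show "j = k" using n by simp
  qed
  then have cR: "card ?R = (n - 1) div 2" unfolding R by (simp add: card_image)
  obtain m where m: "n = 3 * m" using n(2) by blast
  then have m0: "m > 0" using n by simp
  have "2 * pi * real m / real n = 2 * pi / 3" using m0 m by simp
  then have "cos (2 * pi * real m / real n) = - 1 / 2" by (simp only: cos_120)
  then have "0 = ?f m" by simp
  moreover have "m \<in> ?J" using m m0 by auto
  ultimately have 0: "0 \<in> ?R" unfolding R by (rule image_eqI)
  then show "0 \<in> Sum ` unit_root_triples n" by blast
  have "finite ?R" unfolding R by simp
  moreover have "{p \<in> Sum ` unit_root_triples n. p \<in> \<real> \<and> p \<noteq> 0} = ?R - {0}" by auto
  ultimately show "card {p \<in> Sum ` unit_root_triples n. p \<in> \<real> \<and> p \<noteq> 0} + 1 = (n - 1) div 2"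
    using 0 card_Suc_Diff1[of ?R 0] cR by simp
qed

section \<open>Orbits of the triangle group\<close>

definition rot3 :: complex where "rot3 = cis (2 * pi / 3)"

lemma rot3_cube: "rot3 ^ 3 = 1"
  unfolding rot3_def Complex.DeMoivre by simp

lemma rot3_nonreal: "rot3 \<notin> \<real>" "rot3\<^sup>2 \<notin> \<real>"
  by (simp_all add: rot3_def power2_eq_square complex_is_Real_iff sin_120 cos_120)

lemma rot3_distinct: "rot3 \<noteq> 0" "rot3 \<noteq> 1" "rot3\<^sup>2 \<noteq> 1" "rot3\<^sup>2 \<noteq> rot3"
  using rot3_nonreal by (auto simp: power2_eq_square)

lemma cnj_rot3: "cnj rot3 = rot3\<^sup>2"
  by (simp add: rot3_def power2_eq_square complex_eq_iff sin_120 cos_120)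

text \<open>The exponent \<open>2 * k\<close> plays the role of \<open>- k\<close>, which keeps all
  exponents natural.\<close>

lemma rot3_power_inverse: "rot3 ^ (2 * k) * rot3 ^ k = 1"
proof -
  have "rot3 ^ (2 * k) * rot3 ^ k = (rot3 ^ 3) ^ k" by (simp flip: power_add power_mult)
  then show ?thesis by (simp add: rot3_cube)
qed

text \<open>The dihedral orbit written without a group; \<open>dihedral6_orbit\<close> proves the
  agreement.\<close>

definition triangle_orbit :: "complex \<Rightarrow> complex set" where
  "triangle_orbit p = {rot3 ^ k * q | k q. q = p \<or> q = cnj p}"

lemma triangle_orbit_refl: "p \<in> triangle_orbit p"
  unfolding triangle_orbit_def by (auto intro: exI[of _ 0])

lemma triangle_orbit_rot: "rot3 ^ k * q \<in> triangle_orbit p" if "q \<in> triangle_orbit p"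
  using that unfolding triangle_orbit_def by (fastforce simp flip: mult.assoc power_add)

lemma triangle_orbit_cnj:
  assumes "q \<in> triangle_orbit p"
  shows "cnj q \<in> triangle_orbit p"
proof -
  obtain k r where q: "q = rot3 ^ k * r" "r = p \<or> r = cnj p"
    using assms unfolding triangle_orbit_def by blast
  have "cnj q = rot3 ^ (2 * k) * cnj r" unfolding q(1) by (simp add: cnj_rot3 power_mult)
  then show ?thesis using q(2) unfolding triangle_orbit_def by fastforce
qed

lemma triangle_orbit_trans:
  assumes "q \<in> triangle_orbit p"
  shows "triangle_orbit q \<subseteq> triangle_orbit p"
proof
  fix r assume "r \<in> triangle_orbit q"
  then obtain k s where "r = rot3 ^ k * s" "s = q \<or> s = cnj q"
    unfolding triangle_orbit_def by blast
  then show "r \<in> triangle_orbit p" using assms by (auto intro: triangle_orbit_rot triangle_orbit_cnj)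
qed

lemma triangle_orbit_sym:
  assumes "q \<in> triangle_orbit p"
  shows "p \<in> triangle_orbit q"
proof -
  obtain k r where q: "q = rot3 ^ k * r" "r = p \<or> r = cnj p"
    using assms unfolding triangle_orbit_def by blast
  have "rot3 ^ (2 * k) * q = r"
    unfolding q(1) mult.assoc[symmetric] rot3_power_inverse by simp
  then have "r \<in> triangle_orbit q" using triangle_orbit_rot[OF triangle_orbit_refl] by metis
  then show ?thesis using q(2) triangle_orbit_cnj[of r q] by auto
qed

lemma triangle_orbit_eq: "q \<in> triangle_orbit p \<Longrightarrow> triangle_orbit q = triangle_orbit p"
  using triangle_orbit_trans triangle_orbit_sym by blast

lemma triangle_orbit_disjoint:
  "triangle_orbit p \<noteq> triangle_orbit q \<Longrightarrow> triangle_orbit p \<inter> triangle_orbit q = {}"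
  using triangle_orbit_eq by blast

lemma range_rot3_power: "range ((^) rot3) = {1, rot3, rot3\<^sup>2}"
proof (intro equalityI subsetI)
  fix z assume "z \<in> range ((^) rot3)"
  then obtain k where "z = rot3 ^ k" by blast
  also have "k = 3 * (k div 3) + k mod 3" by simp
  also have "rot3 ^ (3 * (k div 3) + k mod 3) = rot3 ^ (k mod 3)"
    by (simp only: power_add power_mult rot3_cube) simp
  finally have "z = rot3 ^ (k mod 3)" .
  moreover have "k mod 3 = 0 \<or> k mod 3 = 1 \<or> k mod 3 = 2" by linarith
  ultimately show "z \<in> {1, rot3, rot3\<^sup>2}" by auto
next
  fix z assume "z \<in> {1, rot3, rot3\<^sup>2}"
  then have "z = rot3 ^ 0 \<or> z = rot3 ^ 1 \<or> z = rot3 ^ 2" by simp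
  then show "z \<in> range ((^) rot3)" by blast
qed

lemma triangle_orbit_explicit:
  "triangle_orbit p = (\<lambda>z. z * p) ` {1, rot3, rot3\<^sup>2} \<union> (\<lambda>z. z * cnj p) ` {1, rot3, rot3\<^sup>2}"
  unfolding range_rot3_power[symmetric] triangle_orbit_def by blast

lemma finite_triangle_orbit: "finite (triangle_orbit p)"
  by (simp add: triangle_orbit_explicit)

lemma triangle_orbit_0: "triangle_orbit 0 = {0}"
  by (auto simp: triangle_orbit_explicit)

lemma card_rot3_image: "p \<noteq> 0 \<Longrightarrow> card ((\<lambda>z. z * p) ` {1, rot3, rot3\<^sup>2}) = 3"
  using rot3_distinct by (subst card_image) (auto simp: inj_on_def)

lemma card_triangle_orbit_real:
  assumes "p \<in> \<real>" "p \<noteq> 0"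
  shows "card (triangle_orbit p) = 3"
  using assms card_rot3_image[of p]
  by (simp add: triangle_orbit_explicit Reals_cnj_iff del: image_insert)

text \<open>The quotient of two real members is a real cube root of unity, hence 1.\<close>

lemma triangle_orbit_real_unique:
  assumes "p \<in> \<real>" "q \<in> \<real>" "p \<noteq> 0" "q \<in> triangle_orbit p"
  shows "q = p"
proof -
  have "q / p \<in> {1, rot3, rot3\<^sup>2}"
    using assms by (auto simp: triangle_orbit_explicit Reals_cnj_iff)
  moreover have "q / p \<in> \<real>" using assms by simp
  ultimately have "q / p = 1" using rot3_nonreal by auto
  then show ?thesis using assms by simp
qed

text \<open>If the multiples of \<open>p\<close> met those of \<open>cnj p\<close>, then
  \<open>cnj p = rot3 ^ m * p\<close> for some \<open>m\<close>, and the orbit member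
  \<open>rot3 ^ (2 * m) * p\<close> would be real.\<close>

lemma triangle_orbit_without_real:
  assumes "p \<noteq> 0" "\<And>q. q \<in> triangle_orbit p \<Longrightarrow> q \<notin> \<real>"
  shows "card (triangle_orbit p) = 6"
proof -
  let ?A = "(\<lambda>z. z * p) ` {1, rot3, rot3\<^sup>2}" and ?B = "(\<lambda>z. z * cnj p) ` {1, rot3, rot3\<^sup>2}"
  have "?A \<inter> ?B = {}"
  proof (rule ccontr)
    assume "?A \<inter> ?B \<noteq> {}"
    then obtain j k where "rot3 ^ j * p = rot3 ^ k * cnj p"
      unfolding range_rot3_power[symmetric] by blast
    then have "rot3 ^ (2 * k) * (rot3 ^ j * p) = (rot3 ^ (2 * k) * rot3 ^ k) * cnj p"
      by (simp only: mult.assoc)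
    then have c: "cnj p = rot3 ^ (2 * k + j) * p"
      unfolding rot3_power_inverse by (simp only: power_add mult.assoc mult_1)
    define m where "m = 2 * k + j"
    \<comment> \<open>Conjugation turns the factor \<open>rot3 ^ (2m)\<close> into \<open>rot3 ^ (4m)\<close> and \<open>p\<close> into \<open>rot3 ^ m * p\<close>.\<close>
    have "cnj (rot3 ^ (2 * m) * p) = (rot3\<^sup>2) ^ (2 * m) * cnj p"
      by (simp add: cnj_rot3)
    also have "\<dots> = rot3 ^ (2 * m) * (rot3 ^ (2 * m) * rot3 ^ m) * p"
      unfolding c m_def[symmetric] power_even_eq
      by (simp only: power_mult[symmetric] power_add[symmetric] mult.assoc[symmetric]) simp
    finally have "rot3 ^ (2 * m) * p \<in> \<real>"
      unfolding rot3_power_inverse by (simp add: Reals_cnj_iff)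
    then show False using assms(2) triangle_orbit_rot[OF triangle_orbit_refl] by blast
  qed
  then show ?thesis
    using assms(1) by (simp add: triangle_orbit_explicit card_Un_disjoint card_rot3_image del: image_insert)
qed

text \<open>The class equation: \<open>{0}\<close> is the only orbit of size 1, orbits of size 3
  correspond to their unique nonzero real point, and all others have size 6.\<close>

lemma card_triangle_orbits:
  assumes fin: "finite C" and 0: "0 \<in> C"
    and closed: "\<And>p. p \<in> C \<Longrightarrow> triangle_orbit p \<subseteq> C"
  defines "N \<equiv> \<lambda>k. card {S \<in> triangle_orbit ` C. card S = k}"
  shows "N 3 = card {p \<in> C. p \<in> \<real> \<and> p \<noteq> 0}"
    and "1 + 3 * N 3 + 6 * N 6 = card C"
proof -
  let ?S = "\<lambda>k. {S \<in> triangle_orbit ` C. card S = k}" and ?R = "{p \<in> C. p \<in> \<real> \<and> p \<noteq> 0}"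
  have "?S 3 = triangle_orbit ` ?R"
  proof (intro equalityI subsetI)
    fix S assume "S \<in> ?S 3"
    then obtain p where p: "p \<in> C" "S = triangle_orbit p" "card (triangle_orbit p) = 3" by auto
    have "p \<noteq> 0" using p(3) by (auto simp: triangle_orbit_0)
    then obtain q where q: "q \<in> triangle_orbit p" "q \<in> \<real>"
      using triangle_orbit_without_real[of p] p(3) by force
    have "q \<noteq> 0" using triangle_orbit_sym[OF q(1)] \<open>p \<noteq> 0\<close> by (auto simp: triangle_orbit_0)
    then show "S \<in> triangle_orbit ` ?R"
      using q closed[OF p(1)] triangle_orbit_eq[OF q(1)] p(2) by blast
  qed (auto simp: card_triangle_orbit_real)
  moreover have "inj_on triangle_orbit ?R"
    by (rule inj_onI) (metis (mono_tags, lifting) mem_Collect_eq triangle_orbit_real_unique triangle_orbit_refl)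
  ultimately show "N 3 = card ?R" unfolding N_def by (simp add: card_image)
  have "triangle_orbit ` C = {{0 :: complex}} \<union> ?S 3 \<union> ?S 6"
  proof (intro equalityI subsetI)
    fix S assume S: "S \<in> triangle_orbit ` C"
    then obtain p where p: "p \<in> C" "S = triangle_orbit p" by blast
    have "card S = 3 \<or> card S = 6" if "p \<noteq> 0"
    proof (cases "\<exists>q \<in> triangle_orbit p. q \<in> \<real>")
      case True
      then obtain q where q: "q \<in> triangle_orbit p" "q \<in> \<real>" by blast
      have "q \<noteq> 0" using triangle_orbit_sym[OF q(1)] that by (auto simp: triangle_orbit_0)
      then show ?thesis using card_triangle_orbit_real[OF q(2)] triangle_orbit_eq[OF q(1)] p by simp
    next
      case False
      then show ?thesis using triangle_orbit_without_real[OF that] p by blast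
    qed
    then show "S \<in> {{0 :: complex}} \<union> ?S 3 \<union> ?S 6" using S p triangle_orbit_0 by (cases "p = 0") auto
  next
    fix S assume "S \<in> {{0 :: complex}} \<union> ?S 3 \<union> ?S 6"
    then show "S \<in> triangle_orbit ` C" using 0 triangle_orbit_0 by (auto intro: rev_image_eqI)
  qed
  moreover have "C = \<Union>(triangle_orbit ` C)" using closed triangle_orbit_refl by blast
  moreover have "card (\<Union>(triangle_orbit ` C)) = (\<Sum>S\<in>triangle_orbit ` C. card S)"
    by (rule card_Union_disjoint)
       (auto simp: pairwise_def disjnt_def finite_triangle_orbit dest!: triangle_orbit_disjoint)
  ultimately have "card C = (\<Sum>S\<in>{{0 :: complex}} \<union> ?S 3 \<union> ?S 6. card S)" by metis
  also have "\<dots> = (\<Sum>S\<in>{{0 :: complex}}. card S) + (\<Sum>S\<in>?S 3. card S) + (\<Sum>S\<in>?S 6. card S)"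
    using fin by (subst sum.union_disjoint; auto)+
  also have "\<dots> = 1 + 3 * N 3 + 6 * N 6" by (simp add: N_def)
  finally show "1 + 3 * N 3 + 6 * N 6 = card C" ..
qed

text \<open>Multiplying a triple by \<open>rot3\<close> multiplies its product by
  \<open>rot3 ^ 3 = 1\<close>, and its elements stay \<open>n\<close>-th roots of unity because 3
  divides \<open>n\<close>.\<close>

lemma triple_sums_closed:
  assumes n: "n > 0" "3 dvd n" and p: "p \<in> Sum ` unit_root_triples n"
  shows "triangle_orbit p \<subseteq> Sum ` unit_root_triples n"
proof -
  let ?T = "unit_root_triples n"
  have rotn: "rot3 ^ n = 1" using n(2) by (auto elim!: dvdE simp: power_mult rot3_cube)
  have rot: "rot3 * q \<in> Sum ` ?T" if q: "q \<in> Sum ` ?T" for q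
  proof -
    obtain A where A: "A \<in> ?T" "q = \<Sum>A" using q by blast
    have inj: "inj_on ((*) rot3) A" using rot3_distinct(1) by (auto simp: inj_on_def)
    have "(*) rot3 ` A \<in> ?T"
      using A(1) inj by (auto simp: unit_root_triples_def card_image prod.reindex prod.distrib
          power_mult_distrib rotn rot3_cube)
    moreover have "\<Sum>((*) rot3 ` A) = rot3 * q"
      using inj A(2) by (simp add: sum.reindex sum_distrib_left)
    ultimately show ?thesis by (metis image_eqI)
  qed
  have cnj: "cnj q \<in> Sum ` ?T" if q: "q \<in> Sum ` ?T" for q
  proof -
    obtain A where A: "A \<in> ?T" "q = \<Sum>A" using q by blast
    have inj: "inj_on cnj A" by (auto simp: inj_on_def)
    have "cnj ` A \<in> ?T"
      using A(1) inj by (auto simp: unit_root_triples_def card_image prod.reindex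
          simp flip: complex_cnj_power cnj_prod)
    moreover have "\<Sum>(cnj ` A) = cnj q"
      using inj A(2) by (simp add: sum.reindex)
    ultimately show ?thesis by (metis image_eqI)
  qed
  have "rot3 ^ k * q \<in> Sum ` ?T" if "q \<in> Sum ` ?T" for k q
    using that by (induction k) (auto simp: rot mult.assoc)
  then show ?thesis using p cnj unfolding triangle_orbit_def by blast
qed

section \<open>Transfer to the group action on the plane\<close>

lemma plane_complex_rotation: "plane_complex (rotation t X) = cis t * plane_complex X"
  by (cases X) (simp add: plane_complex_def rotation_def complex_eq_iff)

lemma plane_complex_x_reflection: "plane_complex (x_reflection X) = cnj (plane_complex X)"
  by (cases X) (simp add: plane_complex_def x_reflection_def complex_eq_iff)

lemma BijGroup_UNIV_simps:
  "carrier (BijGroup UNIV) = {f. bij f}" "\<one>\<^bsub>BijGroup UNIV\<^esub> = id"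
  "bij f \<Longrightarrow> bij g \<Longrightarrow> f \<otimes>\<^bsub>BijGroup UNIV\<^esub> g = f \<circ> g"
  by (auto simp: BijGroup_def Bij_def compose_def fun_eq_iff)

lemma inv_BijGroup_UNIV: "bij f \<Longrightarrow> inv\<^bsub>BijGroup UNIV\<^esub> f = inv_into UNIV f"
  by (simp add: inv_BijGroup Bij_def fun_eq_iff)

lemma carrier_dihedral6:
  "carrier dihedral6 = generate (BijGroup UNIV) {rotation (2 * pi / 3), x_reflection}"
  by (simp add: dihedral6_def)

lemma dihedral6_bij: "g \<in> carrier dihedral6 \<Longrightarrow> bij g"
  using group.generate_in_carrier[OF group_BijGroup dihedral6_generators]
  unfolding carrier_dihedral6 BijGroup_UNIV_simps(1) by blast

lemma dihedral6_generators_mem: "rotation (2 * pi / 3) \<in> carrier dihedral6" "x_reflection \<in> carrier dihedral6"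
  unfolding carrier_dihedral6 by (auto intro: generate.incl)

lemma dihedral6_comp:
  assumes "f \<in> carrier dihedral6" "g \<in> carrier dihedral6"
  shows "f \<circ> g \<in> carrier dihedral6"
  using generate.eng[OF assms[unfolded carrier_dihedral6]]
  by (simp add: BijGroup_UNIV_simps dihedral6_bij assms flip: carrier_dihedral6)

lemma dihedral6_mem_orbit:
  assumes "g \<in> carrier dihedral6"
  shows "plane_complex (g X) \<in> triangle_orbit (plane_complex X)"
proof -
  have gen: "plane_complex (h X) \<in> triangle_orbit (plane_complex X)"
    if "h \<in> {rotation (2 * pi / 3), x_reflection}" for h X
    using that triangle_orbit_rot[OF triangle_orbit_refl, of 1] triangle_orbit_cnj[OF triangle_orbit_refl]
    by (auto simp: plane_complex_rotation plane_complex_x_reflection rot3_def)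
  show ?thesis using assms unfolding carrier_dihedral6
  proof (induction arbitrary: X rule: generate.induct)
    case one
    then show ?case by (simp add: BijGroup_UNIV_simps triangle_orbit_refl)
  next
    case (incl h)
    then show ?case by (rule gen)
  next
    case (inv h)
    then have "bij h" using dihedral6_generators by (auto simp: BijGroup_UNIV_simps)
    then show ?case
      \<comment> \<open>The generator \<open>h\<close> moves the preimage of \<open>X\<close> to
        \<open>X\<close>; symmetry of the orbit relation reverses this.\<close>
      using triangle_orbit_sym[OF gen[OF inv, of "inv_into UNIV h X"]]
      by (simp add: inv_BijGroup_UNIV bij_is_surj surj_f_inv_f)
  next
    case (eng f g)
    then have "bij f" "bij g" by (auto intro!: dihedral6_bij simp: carrier_dihedral6)
    then show ?case
      using triangle_orbit_trans[OF eng.IH(2)[of X]] eng.IH(1)[of "g X"]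
      by (auto simp: BijGroup_UNIV_simps)
  qed
qed

text \<open>Every orbit element is reached by at most one reflection followed by \<open>k\<close>
  rotations.\<close>

lemma dihedral6_orbit:
  "(\<lambda>g. plane_complex (g X)) ` carrier dihedral6 = triangle_orbit (plane_complex X)"
proof (intro equalityI subsetI)
  fix q assume "q \<in> triangle_orbit (plane_complex X)"
  then obtain k p where q: "q = rot3 ^ k * p" "p = plane_complex X \<or> p = cnj (plane_complex X)"
    unfolding triangle_orbit_def by blast
  have "id \<in> carrier dihedral6"
    unfolding carrier_dihedral6 using generate.one[of "BijGroup UNIV"] by (simp add: BijGroup_UNIV_simps)
  then have "\<exists>g\<in>carrier dihedral6. p = plane_complex (g X)"
    using q(2) dihedral6_generators_mem(2) plane_complex_x_reflection[of X] by (metis id_apply)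
  then have "\<exists>g\<in>carrier dihedral6. rot3 ^ k * p = plane_complex (g X)"
  proof (induction k)
    case (Suc k)
    then obtain g where g: "g \<in> carrier dihedral6" "rot3 ^ k * p = plane_complex (g X)" by blast
    then have "rot3 ^ Suc k * p = plane_complex ((rotation (2 * pi / 3) \<circ> g) X)"
      by (simp add: plane_complex_rotation rot3_def mult.assoc)
    then show ?case using dihedral6_comp[OF dihedral6_generators_mem(1) g(1)] by blast
  qed simp
  then show "q \<in> (\<lambda>g. plane_complex (g X)) ` carrier dihedral6" using q(1) by blast
qed (auto intro: dihedral6_mem_orbit)

text \<open>The injective coordinate map preserves both the number of orbits and their sizes;
  restricting the group elements leaves their values at triple points unchanged.\<close>

lemma num_orbits_of_size_eq:
  assumes "n > 0"
  shows "num_orbits_of_size k n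
    = card {S \<in> triangle_orbit ` (Sum ` unit_root_triples n). card S = k}"
proof -
  let ?O = "orbits dihedral6 (triple_points n) (triple_point_action n)"
  have inj: "inj plane_complex" using bij_plane_complex by (rule bij_is_inj)
  have "?O = (\<lambda>X. (\<lambda>g. g X) ` carrier dihedral6) ` triple_points n"
    unfolding orbits_def Setcompr_eq_image
    by (rule image_cong) (auto simp: orbit_def triple_point_action_def)
  then have "(`) plane_complex ` ?O = triangle_orbit ` (plane_complex ` triple_points n)"
    by (simp add: image_image dihedral6_orbit)
  then have O: "(`) plane_complex ` ?O = triangle_orbit ` (Sum ` unit_root_triples n)"
    by (simp only: triple_points_complex[OF assms])
  have c: "card (plane_complex ` S) = card S" for S
    by (intro card_image inj_on_subset[OF inj]) simp
  have "{S \<in> triangle_orbit ` (Sum ` unit_root_triples n). card S = k}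
    = (`) plane_complex ` {S \<in> ?O. card S = k}"
    unfolding O[symmetric] by (auto simp: c)
  also have "card \<dots> = card {S \<in> ?O. card S = k}"
    by (intro card_image inj_onI) (simp add: inj_image_eq_iff[OF inj])
  finally show ?thesis by (simp add: num_orbits_of_size_def)
qed

theorem proposition3p3:
  fixes n :: nat
  assumes "n \<ge> 3" and "3 dvd n"
  shows "int (num_orbits_of_size 3 n) = \<lfloor>(real n - 1) / 2\<rfloor> - 1 \<and>
         real (num_orbits_of_size 6 n) =
           real n * (real n - 3) / 36 - 1 / 2 * real_of_int \<lfloor>(real n - 1) / 2\<rfloor> + 1 / 2"
proof -
  let ?C = "Sum ` unit_root_triples n"
  define x y where "x = num_orbits_of_size 3 n" and "y = num_orbits_of_size 6 n"
  have n: "n > 0" using assms by simp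
  have cC: "card ?C = card (unit_root_triples n)"
    by (rule card_image) (rule inj_on_Sum_unit_root_triples[OF n])
  have T: "6 * card (unit_root_triples n) + 3 * n = n\<^sup>2 + 6"
    by (rule card_unit_root_triples[OF n assms(2)])
  have fin: "finite ?C" using finite_unit_root_triples[OF n] by simp
  note orbits = card_triangle_orbits[OF fin card_real_triple_sums(2)[OF n assms(2)]
      triple_sums_closed[OF n assms(2)], folded num_orbits_of_size_eq[OF n]]
  have x: "x + 1 = (n - 1) div 2"
    using orbits(1) card_real_triple_sums(1)[OF n assms(2)] by (simp add: x_def)
  have "6 * (1 + 3 * x + 6 * y) + 3 * n = n\<^sup>2 + 6"
    using orbits(2) T cC by (simp add: x_def y_def)
  \<comment> \<open>The class equation and the count of triples are combined over the reals, where
    the equation can be solved for \<open>y\<close>.\<close>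
  then have "real (6 * (1 + 3 * x + 6 * y) + 3 * n) = real (n\<^sup>2 + 6)" by (rule arg_cong)
  then have y: "real y = real n * (real n - 3) / 36 - real x / 2"
    by (simp add: power2_eq_square field_simps)
  have "\<lfloor>(real n - 1) / 2\<rfloor> = int ((n - 1) div 2)"
    using n floor_divide_of_nat_eq[of "n - 1" 2, where ?'a = real] by (simp add: of_nat_diff)
  then have f: "\<lfloor>(real n - 1) / 2\<rfloor> = int x + 1" using x by simp
  show ?thesis unfolding x_def[symmetric] y_def[symmetric] f using y by (simp add: field_simps)
qed

end
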